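(* Let $\rho\colon L^\infty_c\to\mathbb{R}$ be a coherent risk measure which admits a representation over finitely many $\mathfrak{P}_c(\Omega)$-constraints, that is, $$\rho(X)=\max_{R\in\mathcal{Q}}E_R[X],\quad X\in L^\infty_c,$$ where $\mathcal{Q}\subseteq\mathfrak{P}_c(\Omega)$ is finite. Then $\rho^Q_E=\rho^Q_D$ for all supported $Q\in\mathfrak{P}_c(\Omega)$.
   Context: $(\Omega,\mathcal{F})$ is a measurable space and $\mathcal{P}$ is a non-empty set of probability measures on it; $c(A):=\sup_{P\in\mathcal{P}}P(A)$ for $A\in\mathcal{F}$. An event $A\in\mathcal{F}$ is $\mathcal{P}$-polar if $c(A)=0$; a property holds $\mathcal{P}$-q.s. if it holds outside a $\mathcal{P}$-polar event. $\mathfrak{P}_c(\Omega)$ is the set of probability measures on $(\Omega,\mathcal{F})$ vanishing on all $\mathcal{P}$-polar events. $L^0_c$ is the space of equivalence classes $[x]_c$ of real-valued random variables up to $\mathcal{P}$-q.s. equality, with order $X\preccurlyeq Y$ iff $x\le y$ $\mathcal{P}$-q.s. for representatives; constants are identified with the classes they induce; $L^\infty_c:=\{X\in L^0_c\mid\exists m>0\colon|X|\preccurlyeq m\}$. For $Q\in\mathfrak{P}_c(\Omega)$, $j_Q([x]_c):=[x]_Q$, where $[x]_Q$ is the class of $x$ modulo $Q$-a.s. equality, and $ca_Q$ is the space of finite signed (countably additive) measures $\mu$ with $|\mu|\ll Q$. $Q\in\mathfrak{P}_c(\Omega)$ is supported if there is $S(Q)\in\mathcal{F}$ such that $Q(S(Q)^c)=0$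 and, whenever $N\in\mathcal{F}$ satisfies $Q(N)=0$, $N\cap S(Q)$ is $\mathcal{P}$-polar. A coherent risk measure is a map $\rho\colon L^\infty_c\to\mathbb{R}$ that is monotone ($X_1\preccurlyeq X_2\Rightarrow\rho(X_1)\le\rho(X_2)$), cash-additive ($\rho(X+m)=\rho(X)+m$ for $m\in\mathbb{R}$), convex, and positively homogeneous ($\rho(\lambda X)=\lambda\rho(X)$ for $\lambda\ge0$). For $Q\in\mathfrak{P}_c(\Omega)$ and $X\in L^\infty_c$: $\rho^Q_E(X):=\inf\{r\in\mathbb{R}\mid j_Q(X)\in j_Q(\{Y\in L^\infty_c\mid\rho(Y)\le r\})\}\in[-\infty,\infty]$, $\overline{\rho}^Q(\mu):=\sup_{X\in L^\infty_c}\big(\int X\,d\mu-\rho^Q_E(X)\big)$ for $\mu\in ca_Q$, and $\rho^Q_D(X):=\sup_{\mu\in ca_Q}\big(\int X\,d\mu-\overline{\rho}^Q(\mu)\big)$. *)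

theory Defs
  imports "HOL-Probability.Probability"
begin

text \<open>
  The measurable space is given by (the space and the \<open>\<sigma>\<close>-algebra of) a measure \<open>M\<close>, whose own
  values play no role; \<open>PP\<close> is the set of priors.
\<close>

section \<open>Polar sets and quasi-sure equivalence classes\<close>

definition capacity :: "'a measure set \<Rightarrow> 'a set \<Rightarrow> real" where
  "capacity PP A = (SUP P\<in>PP. measure P A)"

definition polar :: "'a measure \<Rightarrow> 'a measure set \<Rightarrow> 'a set set" where
  "polar M PP = {A \<in> sets M. capacity PP A = 0}"

definition quasi_surely :: "'a measure \<Rightarrow> 'a measure set \<Rightarrow> ('a \<Rightarrow> bool) \<Rightarrow> bool" where
  "quasi_surely M PP \<phi> \<longleftrightarrow> (\<exists>N\<in>polar M PP. \<forall>\<omega>\<in>space M - N. \<phi> \<omega>)"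

definition prob_c :: "'a measure \<Rightarrow> 'a measure set \<Rightarrow> 'a measure set" where
  "prob_c M PP = {Q. prob_space Q \<and> sets Q = sets M \<and> (\<forall>N\<in>polar M PP. measure Q N = 0)}"

definition qs_class :: "'a measure \<Rightarrow> 'a measure set \<Rightarrow> ('a \<Rightarrow> real) \<Rightarrow> ('a \<Rightarrow> real) set" where
  "qs_class M PP x = {y \<in> borel_measurable M. quasi_surely M PP (\<lambda>\<omega>. x \<omega> = y \<omega>)}"

definition as_class :: "'a measure \<Rightarrow> ('a \<Rightarrow> real) \<Rightarrow> ('a \<Rightarrow> real) set" where
  "as_class Q x = {y \<in> borel_measurable Q. AE \<omega> in Q. x \<omega> = y \<omega>}"

definition L0_c :: "'a measure \<Rightarrow> 'a measure set \<Rightarrow> ('a \<Rightarrow> real) set set" where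
  "L0_c M PP = qs_class M PP ` borel_measurable M"

text \<open>Operations on classes are defined through a chosen representative; the lemmas below show
  that they do not depend on the choice.\<close>

definition c_rep :: "('a \<Rightarrow> real) set \<Rightarrow> 'a \<Rightarrow> real" where
  "c_rep X = (SOME x. x \<in> X)"

definition c_le :: "'a measure \<Rightarrow> 'a measure set \<Rightarrow> ('a \<Rightarrow> real) set \<Rightarrow> ('a \<Rightarrow> real) set \<Rightarrow> bool" where
  "c_le M PP X Y \<longleftrightarrow> quasi_surely M PP (\<lambda>\<omega>. c_rep X \<omega> \<le> c_rep Y \<omega>)"

definition c_const :: "'a measure \<Rightarrow> 'a measure set \<Rightarrow> real \<Rightarrow> ('a \<Rightarrow> real) set" where
  "c_const M PP m = qs_class M PP (\<lambda>\<omega>. m)"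

definition c_add :: "'a measure \<Rightarrow> 'a measure set \<Rightarrow> ('a \<Rightarrow> real) set \<Rightarrow> ('a \<Rightarrow> real) set \<Rightarrow> ('a \<Rightarrow> real) set" where
  "c_add M PP X Y = qs_class M PP (\<lambda>\<omega>. c_rep X \<omega> + c_rep Y \<omega>)"

definition c_scale :: "'a measure \<Rightarrow> 'a measure set \<Rightarrow> real \<Rightarrow> ('a \<Rightarrow> real) set \<Rightarrow> ('a \<Rightarrow> real) set" where
  "c_scale M PP a X = qs_class M PP (\<lambda>\<omega>. a * c_rep X \<omega>)"

definition c_abs :: "'a measure \<Rightarrow> 'a measure set \<Rightarrow> ('a \<Rightarrow> real) set \<Rightarrow> ('a \<Rightarrow> real) set" where
  "c_abs M PP X = qs_class M PP (\<lambda>\<omega>. \<bar>c_rep X \<omega>\<bar>)"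

definition Linf_c :: "'a measure \<Rightarrow> 'a measure set \<Rightarrow> ('a \<Rightarrow> real) set set" where
  "Linf_c M PP = {X \<in> L0_c M PP. \<exists>m>0. c_le M PP (c_abs M PP X) (c_const M PP m)}"

definition j_map :: "'a measure \<Rightarrow> ('a \<Rightarrow> real) set \<Rightarrow> ('a \<Rightarrow> real) set" where
  "j_map Q X = as_class Q (c_rep X)"

definition expect :: "'a measure \<Rightarrow> ('a \<Rightarrow> real) set \<Rightarrow> real" where
  "expect R X = (\<integral>\<omega>. c_rep X \<omega> \<partial>R)"

definition supported :: "'a measure \<Rightarrow> 'a measure set \<Rightarrow> 'a measure \<Rightarrow> bool" where
  "supported M PP Q \<longleftrightarrow> (\<exists>S\<in>sets M. measure Q (space M - S) = 0 \<and>
     (\<forall>N\<in>sets M. measure Q N = 0 \<longrightarrow> N \<inter> S \<in> polar M PP))"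


section \<open>Finite signed measures\<close>

text \<open>Only the values on \<open>sets M\<close> are relevant. Countable additivity forces \<open>\<mu> {} = 0\<close>.\<close>

definition signed_measure :: "'a measure \<Rightarrow> ('a set \<Rightarrow> real) \<Rightarrow> bool" where
  "signed_measure M \<mu> \<longleftrightarrow> (\<forall>A :: nat \<Rightarrow> 'a set. range A \<subseteq> sets M \<longrightarrow> disjoint_family A \<longrightarrow>
     (\<lambda>i. \<mu> (A i)) sums \<mu> (\<Union>i. A i))"

text \<open>Jordan decomposition: \<open>\<mu>\<^sup>+ A\<close> is the supremum of \<open>\<mu> B\<close> over measurable \<open>B \<subseteq> A\<close>, and
  \<open>\<mu>\<^sup>- = (- \<mu>)\<^sup>+\<close>. Since \<open>\<mu> {} = 0\<close>, truncating negative values by \<^const>\<open>ennreal\<close> is harmless.\<close>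

definition pos_var :: "'a measure \<Rightarrow> ('a set \<Rightarrow> real) \<Rightarrow> 'a set \<Rightarrow> ennreal" where
  "pos_var M \<mu> A = (SUP B\<in>{B \<in> sets M. B \<subseteq> A}. ennreal (\<mu> B))"

definition total_var :: "'a measure \<Rightarrow> ('a set \<Rightarrow> real) \<Rightarrow> 'a set \<Rightarrow> ennreal" where
  "total_var M \<mu> A = pos_var M \<mu> A + pos_var M (\<lambda>B. - \<mu> B) A"

definition pos_part :: "'a measure \<Rightarrow> ('a set \<Rightarrow> real) \<Rightarrow> 'a measure" where
  "pos_part M \<mu> = measure_of (space M) (sets M) (pos_var M \<mu>)"

definition signed_integral :: "'a measure \<Rightarrow> ('a set \<Rightarrow> real) \<Rightarrow> ('a \<Rightarrow> real) set \<Rightarrow> real" where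
  "signed_integral M \<mu> X = expect (pos_part M \<mu>) X - expect (pos_part M (\<lambda>A. - \<mu> A)) X"

definition ca :: "'a measure \<Rightarrow> 'a measure \<Rightarrow> ('a set \<Rightarrow> real) set" where
  "ca M Q = {\<mu>. signed_measure M \<mu> \<and> (\<forall>A\<in>sets M. measure Q A = 0 \<longrightarrow> total_var M \<mu> A = 0)}"


section \<open>Risk measures\<close>

definition coherent_risk_measure ::
  "'a measure \<Rightarrow> 'a measure set \<Rightarrow> (('a \<Rightarrow> real) set \<Rightarrow> real) \<Rightarrow> bool" where
  "coherent_risk_measure M PP \<rho> \<longleftrightarrow>
     (\<forall>X\<in>Linf_c M PP. \<forall>Y\<in>Linf_c M PP. c_le M PP X Y \<longrightarrow> \<rho> X \<le> \<rho> Y) \<and>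
     (\<forall>X\<in>Linf_c M PP. \<forall>m. \<rho> (c_add M PP X (c_const M PP m)) = \<rho> X + m) \<and>
     (\<forall>X\<in>Linf_c M PP. \<forall>Y\<in>Linf_c M PP. \<forall>a\<in>{0..1}.
        \<rho> (c_add M PP (c_scale M PP a X) (c_scale M PP (1 - a) Y)) \<le> a * \<rho> X + (1 - a) * \<rho> Y) \<and>
     (\<forall>X\<in>Linf_c M PP. \<forall>a\<ge>0. \<rho> (c_scale M PP a X) = a * \<rho> X)"

definition rho_E :: "'a measure \<Rightarrow> 'a measure set \<Rightarrow> (('a \<Rightarrow> real) set \<Rightarrow> real) \<Rightarrow> 'a measure \<Rightarrow>
    ('a \<Rightarrow> real) set \<Rightarrow> ereal" where
  "rho_E M PP \<rho> Q X = Inf (ereal ` {r. j_map Q X \<in> j_map Q ` {Y \<in> Linf_c M PP. \<rho> Y \<le> r}})"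

definition rho_bar :: "'a measure \<Rightarrow> 'a measure set \<Rightarrow> (('a \<Rightarrow> real) set \<Rightarrow> real) \<Rightarrow> 'a measure \<Rightarrow>
    ('a set \<Rightarrow> real) \<Rightarrow> ereal" where
  "rho_bar M PP \<rho> Q \<mu> = (SUP X\<in>Linf_c M PP. ereal (signed_integral M \<mu> X) - rho_E M PP \<rho> Q X)"

definition rho_D :: "'a measure \<Rightarrow> 'a measure set \<Rightarrow> (('a \<Rightarrow> real) set \<Rightarrow> real) \<Rightarrow> 'a measure \<Rightarrow>
    ('a \<Rightarrow> real) set \<Rightarrow> ereal" where
  "rho_D M PP \<rho> Q X = (SUP \<mu>\<in>ca M Q. ereal (signed_integral M \<mu> X) - rho_bar M PP \<rho> Q \<mu>)"


section \<open>Well-definedness of the operations\<close>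

locale priors =
  fixes M :: "'a measure" and PP :: "'a measure set"
  assumes nonempty: "PP \<noteq> {}"
    and prob: "P \<in> PP \<Longrightarrow> prob_space P \<and> sets P = sets M"
begin

lemma polar_iff: "A \<in> polar M PP \<longleftrightarrow> A \<in> sets M \<and> (\<forall>P\<in>PP. measure P A = 0)"
proof -
  have bdd: "bdd_above ((\<lambda>P. measure P A) ` PP)"
    using prob by (auto intro!: bdd_aboveI[of _ 1] prob_space.prob_le_1)
  have "(SUP P\<in>PP. measure P A) = 0 \<longleftrightarrow> (\<forall>P\<in>PP. measure P A = 0)"
  proof
    assume "(SUP P\<in>PP. measure P A) = 0"
    then show "\<forall>P\<in>PP. measure P A = 0"
      using cSUP_upper[OF _ bdd] by (metis antisym measure_nonneg)
  next
    assume "\<forall>P\<in>PP. measure P A = 0"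
    then have "(\<lambda>P. measure P A) ` PP = {0}"
      using nonempty by auto
    then show "(SUP P\<in>PP. measure P A) = 0" by simp
  qed
  then show ?thesis by (simp add: polar_def capacity_def)
qed

lemma polar_Un: "A \<in> polar M PP \<Longrightarrow> B \<in> polar M PP \<Longrightarrow> A \<union> B \<in> polar M PP"
proof -
  assume A: "A \<in> polar M PP" and B: "B \<in> polar M PP"
  have "measure P (A \<union> B) = 0" if P: "P \<in> PP" for P
  proof -
    interpret prob_space P using prob[OF P] by simp
    have "measure P (A \<union> B) \<le> measure P A + measure P B"
      using A B prob[OF P] by (intro measure_Un_le) (auto simp: polar_iff)
    also have "\<dots> = 0" using A B P by (simp add: polar_iff)
    finally show ?thesis by (simp add: antisym)
  qed
  then show ?thesis using A B by (auto simp: polar_iff)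
qed

lemma quasi_surely_mp2:
  assumes "quasi_surely M PP \<phi>" "quasi_surely M PP \<psi>"
    and "\<And>\<omega>. \<omega> \<in> space M \<Longrightarrow> \<phi> \<omega> \<Longrightarrow> \<psi> \<omega> \<Longrightarrow> \<theta> \<omega>"
  shows "quasi_surely M PP \<theta>"
proof -
  obtain N1 N2 where N: "N1 \<in> polar M PP" "\<forall>\<omega>\<in>space M - N1. \<phi> \<omega>"
    "N2 \<in> polar M PP" "\<forall>\<omega>\<in>space M - N2. \<psi> \<omega>"
    using assms(1,2) by (auto simp: quasi_surely_def)
  show ?thesis
    unfolding quasi_surely_def
    using N assms(3) by (intro bexI[OF _ polar_Un[OF N(1) N(3)]]) auto
qed

lemma quasi_surelyI: "(\<And>\<omega>. \<omega> \<in> space M \<Longrightarrow> \<phi> \<omega>) \<Longrightarrow> quasi_surely M PP \<phi>"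
  unfolding quasi_surely_def by (intro bexI[of _ "{}"]) (auto simp: polar_iff)

lemma qs_class_eq_iff:
  assumes "x \<in> borel_measurable M" "y \<in> borel_measurable M"
  shows "qs_class M PP x = qs_class M PP y \<longleftrightarrow> quasi_surely M PP (\<lambda>\<omega>. x \<omega> = y \<omega>)"
proof
  have "y \<in> qs_class M PP y" using assms by (auto simp: qs_class_def intro: quasi_surelyI)
  moreover assume "qs_class M PP x = qs_class M PP y"
  ultimately have "y \<in> qs_class M PP x" by (simp only:)
  then show "quasi_surely M PP (\<lambda>\<omega>. x \<omega> = y \<omega>)" by (simp add: qs_class_def)
next
  assume xy: "quasi_surely M PP (\<lambda>\<omega>. x \<omega> = y \<omega>)"
  have "quasi_surely M PP (\<lambda>\<omega>. x \<omega> = z \<omega>) \<longleftrightarrow> quasi_surely M PP (\<lambda>\<omega>. y \<omega> = z \<omega>)" for z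
    by (rule iffI; erule quasi_surely_mp2[OF xy]; metis)
  then show "qs_class M PP x = qs_class M PP y"
    by (simp add: qs_class_def)
qed

lemma c_rep_qs_class:
  assumes "x \<in> borel_measurable M"
  shows "c_rep (qs_class M PP x) \<in> borel_measurable M"
    and "quasi_surely M PP (\<lambda>\<omega>. x \<omega> = c_rep (qs_class M PP x) \<omega>)"
proof -
  have "x \<in> qs_class M PP x" using assms by (auto simp: qs_class_def intro: quasi_surelyI)
  then have "c_rep (qs_class M PP x) \<in> qs_class M PP x" unfolding c_rep_def by (rule someI[where P = "\<lambda>y. y \<in> qs_class M PP x"])
  then show "c_rep (qs_class M PP x) \<in> borel_measurable M"
    and "quasi_surely M PP (\<lambda>\<omega>. x \<omega> = c_rep (qs_class M PP x) \<omega>)"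
    by (auto simp: qs_class_def)
qed

lemma c_le_qs_class:
  assumes x: "x \<in> borel_measurable M" and y: "y \<in> borel_measurable M"
  shows "c_le M PP (qs_class M PP x) (qs_class M PP y) \<longleftrightarrow> quasi_surely M PP (\<lambda>\<omega>. x \<omega> \<le> y \<omega>)"
proof -
  let ?x = "c_rep (qs_class M PP x)" and ?y = "c_rep (qs_class M PP y)"
  have xy: "quasi_surely M PP (\<lambda>\<omega>. x \<omega> = ?x \<omega> \<and> y \<omega> = ?y \<omega>)"
    by (rule quasi_surely_mp2[OF c_rep_qs_class(2)[OF x] c_rep_qs_class(2)[OF y]]) simp
  show ?thesis unfolding c_le_def
    by (rule iffI; erule quasi_surely_mp2[OF xy]) auto
qed

lemma c_add_qs_class:
  assumes x: "x \<in> borel_measurable M" and y: "y \<in> borel_measurable M"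
  shows "c_add M PP (qs_class M PP x) (qs_class M PP y) = qs_class M PP (\<lambda>\<omega>. x \<omega> + y \<omega>)"
proof -
  have "quasi_surely M PP
    (\<lambda>\<omega>. c_rep (qs_class M PP x) \<omega> + c_rep (qs_class M PP y) \<omega> = x \<omega> + y \<omega>)"
    by (rule quasi_surely_mp2[OF c_rep_qs_class(2)[OF x] c_rep_qs_class(2)[OF y]]) simp
  moreover have "(\<lambda>\<omega>. c_rep (qs_class M PP x) \<omega> + c_rep (qs_class M PP y) \<omega>) \<in> borel_measurable M"
    using c_rep_qs_class(1)[OF x] c_rep_qs_class(1)[OF y] by measurable
  moreover have "(\<lambda>\<omega>. x \<omega> + y \<omega>) \<in> borel_measurable M"
    using x y by measurable
  ultimately show ?thesis by (simp only: c_add_def qs_class_eq_iff)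
qed

lemma c_scale_qs_class:
  assumes x: "x \<in> borel_measurable M"
  shows "c_scale M PP a (qs_class M PP x) = qs_class M PP (\<lambda>\<omega>. a * x \<omega>)"
proof -
  have "quasi_surely M PP (\<lambda>\<omega>. a * c_rep (qs_class M PP x) \<omega> = a * x \<omega>)"
    by (rule quasi_surely_mp2[OF c_rep_qs_class(2)[OF x] c_rep_qs_class(2)[OF x]]) simp
  moreover have "(\<lambda>\<omega>. a * c_rep (qs_class M PP x) \<omega>) \<in> borel_measurable M"
    using c_rep_qs_class(1)[OF x] by measurable
  moreover have "(\<lambda>\<omega>. a * x \<omega>) \<in> borel_measurable M"
    using x by measurable
  ultimately show ?thesis by (simp only: c_scale_def qs_class_eq_iff)
qed

lemma c_abs_qs_class:
  assumes x: "x \<in> borel_measurable M"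
  shows "c_abs M PP (qs_class M PP x) = qs_class M PP (\<lambda>\<omega>. \<bar>x \<omega>\<bar>)"
proof -
  have "quasi_surely M PP (\<lambda>\<omega>. \<bar>c_rep (qs_class M PP x) \<omega>\<bar> = \<bar>x \<omega>\<bar>)"
    by (rule quasi_surely_mp2[OF c_rep_qs_class(2)[OF x] c_rep_qs_class(2)[OF x]]) simp
  moreover have "(\<lambda>\<omega>. \<bar>c_rep (qs_class M PP x) \<omega>\<bar>) \<in> borel_measurable M"
    using c_rep_qs_class(1)[OF x] by measurable
  moreover have "(\<lambda>\<omega>. \<bar>x \<omega>\<bar>) \<in> borel_measurable M"
    using x by measurable
  ultimately show ?thesis by (simp only: c_abs_def qs_class_eq_iff)
qed

lemma AE_if_quasi_surely:
  assumes Q: "Q \<in> prob_c M PP" and qs: "quasi_surely M PP \<phi>"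
  shows "AE \<omega> in Q. \<phi> \<omega>"
proof -
  interpret prob_space Q using Q by (simp add: prob_c_def)
  have sets: "sets Q = sets M" using Q by (simp add: prob_c_def)
  obtain N where N: "N \<in> polar M PP" "\<forall>\<omega>\<in>space M - N. \<phi> \<omega>"
    using qs by (auto simp: quasi_surely_def)
  have "emeasure Q N = 0" using N Q by (simp add: prob_c_def emeasure_eq_measure)
  then show ?thesis
    using N sets_eq_imp_space_eq[OF sets] sets by (intro AE_I[of _ _ N]) (auto simp: polar_iff)
qed

lemma j_map_qs_class:
  assumes Q: "Q \<in> prob_c M PP" and x: "x \<in> borel_measurable M"
  shows "j_map Q (qs_class M PP x) = as_class Q x"
proof -
  have "AE \<omega> in Q. x \<omega> = c_rep (qs_class M PP x) \<omega>"
    by (rule AE_if_quasi_surely[OF Q c_rep_qs_class(2)[OF x]])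
  then show ?thesis by (auto simp: j_map_def as_class_def)
qed

lemma expect_qs_class:
  assumes Q: "Q \<in> prob_c M PP" and x: "x \<in> borel_measurable M"
  shows "expect Q (qs_class M PP x) = (\<integral>\<omega>. x \<omega> \<partial>Q)"
proof -
  have "sets Q = sets M" using Q by (simp add: prob_c_def)
  then have "borel_measurable Q = borel_measurable M" by (rule measurable_cong_sets) simp
  moreover have "AE \<omega> in Q. c_rep (qs_class M PP x) \<omega> = x \<omega>"
    using AE_if_quasi_surely[OF Q c_rep_qs_class(2)[OF x]] by (simp add: eq_commute)
  ultimately show ?thesis unfolding expect_def
    using x c_rep_qs_class(1)[OF x] by (intro integral_cong_AE) auto
qed

end

lemma signed_measure_empty:
  assumes "signed_measure M \<mu>"
  shows "\<mu> {} = 0"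
proof -
  have "(\<lambda>i::nat. \<mu> {}) sums \<mu> (\<Union>i::nat. {})"
    using assms[unfolded signed_measure_def, rule_format, of "\<lambda>_. {}"]
    by (simp add: disjoint_family_on_def)
  then have "summable (\<lambda>i::nat. \<mu> {})" by (rule sums_summable)
  then have "(\<lambda>i::nat. \<mu> {}) \<longlonglongrightarrow> 0" by (rule summable_LIMSEQ_zero)
  then show ?thesis by (simp add: LIMSEQ_const_iff)
qed

lemma signed_measure_Un:
  assumes \<mu>: "signed_measure M \<mu>" and AB: "A \<in> sets M" "B \<in> sets M" "A \<inter> B = {}"
  shows "\<mu> (A \<union> B) = \<mu> A + \<mu> B"
proof -
  have "range (binaryset A B) \<subseteq> sets M" using AB by (auto simp: range_binaryset_eq)
  moreover have "disjoint_family (binaryset A B)"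
    using AB by (auto simp: disjoint_family_on_def binaryset_def)
  ultimately have "(\<lambda>i. \<mu> (binaryset A B i)) sums \<mu> (\<Union>i. binaryset A B i)"
    using \<mu> unfolding signed_measure_def by blast
  moreover have "(\<lambda>i. \<mu> (binaryset A B i)) sums (\<mu> A + \<mu> B)"
    by (rule binaryset_sums) (rule signed_measure_empty[OF \<mu>])
  ultimately show ?thesis by (simp add: UN_binaryset_eq sums_unique2)
qed

lemma pos_var_Un:
  assumes \<mu>: "signed_measure M \<mu>" and AB: "A \<inter> B = {}"
  shows "pos_var M \<mu> A + pos_var M \<mu> B \<le> pos_var M \<mu> (A \<union> B)"
proof -
  have *: "ennreal (\<mu> C) + ennreal (\<mu> D) \<le> pos_var M \<mu> (A \<union> B)"
    if C: "C \<in> sets M" "C \<subseteq> A" and D: "D \<in> sets M" "D \<subseteq> B" for C D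
  proof -
    define C' D' where "C' = (if \<mu> C < 0 then {} else C)" and "D' = (if \<mu> D < 0 then {} else D)"
    have C': "C' \<in> sets M" "C' \<subseteq> A" "ennreal (\<mu> C) = ennreal (\<mu> C')" "0 \<le> \<mu> C'"
      and D': "D' \<in> sets M" "D' \<subseteq> B" "ennreal (\<mu> D) = ennreal (\<mu> D')" "0 \<le> \<mu> D'"
      using C D signed_measure_empty[OF \<mu>] by (auto simp: C'_def D'_def ennreal_neg)
    have "ennreal (\<mu> C') + ennreal (\<mu> D') = ennreal (\<mu> (C' \<union> D'))"
      using C' D' AB by (subst signed_measure_Un[OF \<mu>]) auto
    also have "\<dots> \<le> pos_var M \<mu> (A \<union> B)"
      unfolding pos_var_def using C' D' by (intro SUP_upper) auto
    finally show ?thesis using C' D' by simp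
  qed
  have "pos_var M \<mu> A + pos_var M \<mu> B =
      (SUP D\<in>{D \<in> sets M. D \<subseteq> B}. SUP C\<in>{C \<in> sets M. C \<subseteq> A}. ennreal (\<mu> C) + ennreal (\<mu> D))"
  proof -
    have ne: "{C \<in> sets M. C \<subseteq> A} \<noteq> {}" for A :: "'a set" by blast
    show ?thesis
      unfolding pos_var_def
      by (simp only: ennreal_SUP_add_left[OF ne, symmetric] ennreal_SUP_add_right[OF ne])
  qed
  also have "\<dots> \<le> pos_var M \<mu> (A \<union> B)"
    using * by (intro SUP_least) auto
  finally show ?thesis .
qed

lemma pos_var_mono: "A \<subseteq> B \<Longrightarrow> pos_var M \<mu> A \<le> pos_var M \<mu> B"
  unfolding pos_var_def by (rule SUP_subset_mono) auto

lemma pos_var_empty: "signed_measure M \<mu> \<Longrightarrow> pos_var M \<mu> {} = 0"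
proof -
  assume "signed_measure M \<mu>"
  moreover have "{B \<in> sets M. B \<subseteq> {}} = {{}}" by blast
  ultimately show ?thesis by (simp only: pos_var_def) (simp add: signed_measure_empty)
qed

lemma emeasure_pos_part:
  assumes \<mu>: "signed_measure M \<mu>" and A: "A \<in> sets M"
  shows "emeasure (pos_part M \<mu>) A = pos_var M \<mu> A"
proof -
  have "countably_additive (sets M) (pos_var M \<mu>)"
  proof (rule countably_additiveI)
    fix A :: "nat \<Rightarrow> 'a set"
    assume A: "range A \<subseteq> sets M" "disjoint_family A"
    show "(\<Sum>i. pos_var M \<mu> (A i)) = pos_var M \<mu> (\<Union>i. A i)"
    proof (rule antisym)
      have "(\<Sum>i<n. pos_var M \<mu> (A i)) \<le> pos_var M \<mu> (\<Union>i<n. A i)" for n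
      proof (induction n)
        case 0
        then show ?case by simp
      next
        case (Suc n)
        have "(\<Sum>i<Suc n. pos_var M \<mu> (A i)) \<le> pos_var M \<mu> (\<Union>i<n. A i) + pos_var M \<mu> (A n)"
          using Suc by (simp add: add_right_mono)
        also have "\<dots> \<le> pos_var M \<mu> ((\<Union>i<n. A i) \<union> A n)"
        proof (rule pos_var_Un[OF \<mu>])
          have "A i \<inter> A n = {}" if "i < n" for i
            using A(2) that by (simp add: disjoint_family_on_def)
          then show "(\<Union>i<n. A i) \<inter> A n = {}" by blast
        qed
        also have "(\<Union>i<n. A i) \<union> A n = (\<Union>i<Suc n. A i)" by (auto simp: less_Suc_eq)
        finally show ?case .
      qed
      then have "(\<Sum>i<n. pos_var M \<mu> (A i)) \<le> pos_var M \<mu> (\<Union>i. A i)" for n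
        by (rule order_trans) (auto intro: pos_var_mono)
      then show "(\<Sum>i. pos_var M \<mu> (A i)) \<le> pos_var M \<mu> (\<Union>i. A i)"
        by (intro suminf_le_const) auto
    next
      have "ennreal (\<mu> B) \<le> (\<Sum>i. pos_var M \<mu> (A i))"
        if B: "B \<in> sets M" "B \<subseteq> (\<Union>i. A i)" for B
      proof -
        have "(\<lambda>i. \<mu> (B \<inter> A i)) sums \<mu> (\<Union>i. B \<inter> A i)"
        proof (rule \<mu>[unfolded signed_measure_def, rule_format])
          show "range (\<lambda>i. B \<inter> A i) \<subseteq> sets M" using A(1) B(1) by blast
          show "disjoint_family (\<lambda>i. B \<inter> A i)" using A(2) unfolding disjoint_family_on_def by blast
        qed
        moreover have "(\<Union>i. B \<inter> A i) = B" using B by auto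
        ultimately have "(\<lambda>n. ennreal (\<Sum>i<n. \<mu> (B \<inter> A i))) \<longlonglongrightarrow> ennreal (\<mu> B)"
          by (intro tendsto_ennrealI) (simp add: sums_def)
        moreover have "ennreal (\<Sum>i<n. \<mu> (B \<inter> A i)) \<le> (\<Sum>i. pos_var M \<mu> (A i))" for n
        proof -
          have "ennreal (\<Sum>i<n. \<mu> (B \<inter> A i)) \<le> ennreal (\<Sum>i<n. max 0 (\<mu> (B \<inter> A i)))"
            by (intro ennreal_leI sum_mono) simp
          also have "\<dots> = (\<Sum>i<n. ennreal (\<mu> (B \<inter> A i)))"
            by (subst sum_ennreal[symmetric]) (simp_all only: ennreal_max_0 max.cobounded1)
          also have "\<dots> \<le> (\<Sum>i<n. pos_var M \<mu> (A i))"
            unfolding pos_var_def using A B by (intro sum_mono SUP_upper) auto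
          also have "\<dots> \<le> (\<Sum>i. pos_var M \<mu> (A i))" by (intro sum_le_suminf) auto
          finally show ?thesis .
        qed
        ultimately show ?thesis by (intro LIMSEQ_le_const2) auto
      qed
      then show "pos_var M \<mu> (\<Union>i. A i) \<le> (\<Sum>i. pos_var M \<mu> (A i))"
        unfolding pos_var_def[of M \<mu> "\<Union>i. A i"] by (intro SUP_least) auto
    qed
  qed
  then show ?thesis
    using A pos_var_empty[OF \<mu>] sets.sigma_algebra_axioms[of M]
    by (simp add: pos_part_def emeasure_measure_of_sigma positive_def)
qed

end

theory Submission
  imports Defs
begin

text \<open>
  Let \<open>S\<close> be a support of \<open>Q\<close>. The class \<open>j\<^sub>Q(X)\<close> determines \<open>X\<close> on \<open>S\<close> up to a polar event and says
  nothing about its values on the complement of \<open>S\<close>. Subtracting a large constant \<open>k\<close> from \<open>X\<close> off \<open>S\<close> therefore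
  gives a competitor in the infimum that defines \<open>\<rho>\<^sup>Q\<^sub>E(X)\<close>, and it pushes \<open>E\<^sub>R\<close> arbitrarily low for
  every \<open>R\<close> that charges the complement of \<open>S\<close>. As there are only finitely many \<open>R\<close>, one \<open>k\<close>
  serves all of them, and only the measures concentrated on \<open>S\<close> survive:
  \<open>\<rho>\<^sup>Q\<^sub>E(X) = sup {E\<^sub>R[X] | R \<in> \<Q>, R(S\<^sup>c) = 0}\<close> (lemma \<open>rho_E_eq_SUP\<close>), which is \<open>-\<infinity>\<close> for every \<open>X\<close>
  if no such \<open>R\<close> exists.

  An \<open>R \<in> \<Q>\<close> concentrated on \<open>S\<close> is absolutely continuous with respect to \<open>Q\<close>, so it
  is one of the measures over which \<open>\<rho>\<^sup>Q\<^sub>D\<close> takes its supremum, and by the formula its penalty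
  \<open>\<rho>\<^sup>Q\<close>-bar is at most \<open>0\<close>. Hence \<open>\<rho>\<^sup>Q\<^sub>D \<ge> \<rho>\<^sup>Q\<^sub>E\<close>. The reverse inequality is the
  general inequality between a function and its biconjugate.
\<close>

section \<open>Bounded classes and their expectations\<close>

context priors
begin

lemma qs_class_in_Linf_c:
  assumes x: "x \<in> borel_measurable M" and bound: "quasi_surely M PP (\<lambda>\<omega>. \<bar>x \<omega>\<bar> \<le> m)"
  shows "qs_class M PP x \<in> Linf_c M PP"
proof -
  have "quasi_surely M PP (\<lambda>\<omega>. \<bar>x \<omega>\<bar> \<le> max m 1)"
    by (rule quasi_surely_mp2[OF bound bound]) simp
  moreover have "(\<lambda>\<omega>. \<bar>x \<omega>\<bar>) \<in> borel_measurable M" using x by measurable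
  ultimately have "c_le M PP (c_abs M PP (qs_class M PP x)) (c_const M PP (max m 1))"
    by (simp add: c_abs_qs_class[OF x] c_const_def c_le_qs_class)
  moreover have "max m 1 > 0" by simp
  ultimately show ?thesis
    unfolding Linf_c_def L0_c_def using x by blast
qed

lemma c_rep_Linf_c:
  assumes "X \<in> Linf_c M PP"
  shows "c_rep X \<in> borel_measurable M"
    and "\<exists>m. quasi_surely M PP (\<lambda>\<omega>. \<bar>c_rep X \<omega>\<bar> \<le> m)"
proof -
  obtain x m where x: "x \<in> borel_measurable M" and X: "X = qs_class M PP x"
    and m: "c_le M PP (c_abs M PP X) (c_const M PP m)"
    using assms by (auto simp: Linf_c_def L0_c_def)
  have "(\<lambda>\<omega>. \<bar>x \<omega>\<bar>) \<in> borel_measurable M" using x by measurable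
  then have "quasi_surely M PP (\<lambda>\<omega>. \<bar>x \<omega>\<bar> \<le> m)"
    using m by (simp add: X c_abs_qs_class[OF x] c_const_def c_le_qs_class)
  then have "quasi_surely M PP (\<lambda>\<omega>. \<bar>c_rep X \<omega>\<bar> \<le> m)"
    unfolding X by (rule quasi_surely_mp2[OF _ c_rep_qs_class(2)[OF x]]) simp
  then show "\<exists>m. quasi_surely M PP (\<lambda>\<omega>. \<bar>c_rep X \<omega>\<bar> \<le> m)" ..
  show "c_rep X \<in> borel_measurable M" unfolding X by (rule c_rep_qs_class(1)[OF x])
qed

lemma borel_measurable_prob_c:
  assumes "R \<in> prob_c M PP"
  shows "borel_measurable R = borel_measurable M"
  using assms by (intro measurable_cong_sets) (simp_all add: prob_c_def)

lemma integrable_c_rep: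
  assumes R: "R \<in> prob_c M PP" and X: "X \<in> Linf_c M PP"
  shows "integrable R (c_rep X)"
proof -
  interpret prob_space R using R by (simp add: prob_c_def)
  obtain m where "quasi_surely M PP (\<lambda>\<omega>. \<bar>c_rep X \<omega>\<bar> \<le> m)"
    using c_rep_Linf_c(2)[OF X] by blast
  then have "AE \<omega> in R. norm (c_rep X \<omega>) \<le> m"
    using AE_if_quasi_surely[OF R] by simp
  then show ?thesis
    using c_rep_Linf_c(1)[OF X] borel_measurable_prob_c[OF R]
    by (intro integrable_const_bound) auto
qed

lemma j_map_eq_iff_AE:
  assumes Q: "Q \<in> prob_c M PP" and X: "X \<in> Linf_c M PP" and Y: "Y \<in> Linf_c M PP"
  shows "j_map Q X = j_map Q Y \<longleftrightarrow> (AE \<omega> in Q. c_rep X \<omega> = c_rep Y \<omega>)"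
proof
  have "c_rep Y \<in> j_map Q Y"
    using c_rep_Linf_c(1)[OF Y] by (simp add: j_map_def as_class_def borel_measurable_prob_c[OF Q])
  moreover assume "j_map Q X = j_map Q Y"
  ultimately have "c_rep Y \<in> j_map Q X" by (simp only:)
  then show "AE \<omega> in Q. c_rep X \<omega> = c_rep Y \<omega>"
    by (simp add: j_map_def as_class_def)
next
  assume "AE \<omega> in Q. c_rep X \<omega> = c_rep Y \<omega>"
  then show "j_map Q X = j_map Q Y"
    unfolding j_map_def as_class_def by auto
qed

section \<open>Measures concentrated on the support\<close>

text \<open>A \<open>Q\<close>-null set meets the support in a polar set, on which every measure in \<open>\<PP>\<^sub>c(\<Omega>)\<close>
  vanishes.\<close>

lemma null_set_if_concentrated_on_support:
  assumes S: "S \<in> sets M" and polar: "\<And>N. N \<in> sets M \<Longrightarrow> measure Q N = 0 \<Longrightarrow> N \<inter> S \<in> polar M PP"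
    and R: "R \<in> prob_c M PP" and RS: "measure R (space M - S) = 0"
    and N: "N \<in> sets M" and QN: "measure Q N = 0"
  shows "measure R N = 0"
proof -
  interpret prob_space R using R by (simp add: prob_c_def)
  have sets: "sets R = sets M" using R by (simp add: prob_c_def)
  have "measure R N \<le> measure R ((N \<inter> S) \<union> (space M - S))"
    using N S sets sets.sets_into_space[OF N] by (intro finite_measure_mono) auto
  also have "\<dots> \<le> measure R (N \<inter> S) + measure R (space M - S)"
    using N S sets by (intro measure_Un_le) auto
  also have "\<dots> = 0"
    using polar[OF N QN] R RS by (simp add: prob_c_def)
  finally show ?thesis by (simp add: antisym)
qed

lemma expect_cong_absolutely_continuous:
  assumes Q: "Q \<in> prob_c M PP" and R: "R \<in> prob_c M PP"
    and ac: "\<And>N. N \<in> sets M \<Longrightarrow> measure Q N = 0 \<Longrightarrow> measure R N = 0"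
    and X: "X \<in> Linf_c M PP" and Y: "Y \<in> Linf_c M PP" and XY: "j_map Q X = j_map Q Y"
  shows "expect R X = expect R Y"
proof -
  interpret Q: prob_space Q using Q by (simp add: prob_c_def)
  interpret R: prob_space R using R by (simp add: prob_c_def)
  have sets: "sets Q = sets M" "sets R = sets M" using Q R by (simp_all add: prob_c_def)
  have "absolutely_continuous Q R"
    using ac sets
    by (auto simp: absolutely_continuous_def null_sets_def Q.emeasure_eq_measure R.emeasure_eq_measure)
  moreover have "AE \<omega> in Q. c_rep X \<omega> = c_rep Y \<omega>"
    using XY by (simp add: j_map_eq_iff_AE[OF Q X Y])
  ultimately have "AE \<omega> in R. c_rep X \<omega> = c_rep Y \<omega>"
    using sets by (intro absolutely_continuous_AE[of R Q]) simp_all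
  then show ?thesis
    unfolding expect_def
    using c_rep_Linf_c(1)[OF X] c_rep_Linf_c(1)[OF Y] borel_measurable_prob_c[OF R]
    by (intro integral_cong_AE) auto
qed

text \<open>The competitor in the infimum defining \<open>\<rho>\<^sup>Q\<^sub>E(X)\<close>; for \<open>A\<close> the complement of
  the support it has the same class modulo \<open>Q\<close> as \<open>X\<close>.\<close>

definition lowered :: "'a set \<Rightarrow> real \<Rightarrow> ('a \<Rightarrow> real) set \<Rightarrow> ('a \<Rightarrow> real) set" where
  "lowered A k X = qs_class M PP (\<lambda>\<omega>. c_rep X \<omega> - k * indicator A \<omega>)"

lemma
  assumes A: "A \<in> sets M" and X: "X \<in> Linf_c M PP"
  shows lowered_in_Linf_c: "lowered A k X \<in> Linf_c M PP"
    and j_map_lowered: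
      "Q \<in> prob_c M PP \<Longrightarrow> measure Q A = 0 \<Longrightarrow> j_map Q (lowered A k X) = j_map Q X"
    and expect_lowered:
      "R \<in> prob_c M PP \<Longrightarrow> expect R (lowered A k X) = expect R X - k * measure R A"
proof -
  have meas: "(\<lambda>\<omega>. c_rep X \<omega> - k * indicator A \<omega>) \<in> borel_measurable M"
    using A c_rep_Linf_c(1)[OF X] by measurable
  obtain m where m: "quasi_surely M PP (\<lambda>\<omega>. \<bar>c_rep X \<omega>\<bar> \<le> m)"
    using c_rep_Linf_c(2)[OF X] by blast
  have "quasi_surely M PP (\<lambda>\<omega>. \<bar>c_rep X \<omega> - k * indicator A \<omega>\<bar> \<le> m + \<bar>k\<bar>)"
    by (rule quasi_surely_mp2[OF m m]) (auto simp: indicator_def)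
  then show "lowered A k X \<in> Linf_c M PP"
    unfolding lowered_def by (rule qs_class_in_Linf_c[OF meas])
  {
    assume Q: "Q \<in> prob_c M PP" and QA: "measure Q A = 0"
    interpret prob_space Q using Q by (simp add: prob_c_def)
    have "AE \<omega> in Q. \<omega> \<notin> A"
      using A Q QA by (intro AE_not_in) (simp add: null_sets_def prob_c_def emeasure_eq_measure)
    then have "AE \<omega> in Q. c_rep X \<omega> - k * indicator A \<omega> = c_rep X \<omega>"
      by eventually_elim simp
    then show "j_map Q (lowered A k X) = j_map Q X"
      unfolding lowered_def j_map_qs_class[OF Q meas] unfolding j_map_def as_class_def by auto
  }
  {
    assume R: "R \<in> prob_c M PP"
    interpret prob_space R using R by (simp add: prob_c_def)
    have "A \<in> sets R" using A R by (simp add: prob_c_def)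
    then show "expect R (lowered A k X) = expect R X - k * measure R A"
      unfolding lowered_def expect_qs_class[OF R meas] unfolding expect_def
      using integrable_c_rep[OF R X]
      by (subst Bochner_Integration.integral_diff) (auto simp: emeasure_eq_measure)
  }
qed

text \<open>Finitely many measures charging \<open>A\<close> are brought below \<open>t\<close> by one and the same \<open>k\<close>; the
  others do not notice the change.\<close>

lemma exists_lowered_expect_le:
  assumes A: "A \<in> sets M" and X: "X \<in> Linf_c M PP" and fin: "finite QQ" and QQ: "QQ \<subseteq> prob_c M PP"
    and t: "\<And>R. R \<in> QQ \<Longrightarrow> measure R A = 0 \<Longrightarrow> expect R X \<le> t"
  shows "\<exists>k. \<forall>R\<in>QQ. expect R (lowered A k X) \<le> t"
proof -
  obtain k where k: "\<And>R. R \<in> QQ \<Longrightarrow> (expect R X - t) / measure R A \<le> k"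
    using bdd_above_finite[OF finite_imageI[OF fin, of "\<lambda>R. (expect R X - t) / measure R A"]]
    by (auto simp: bdd_above_def)
  have "expect R (lowered A k X) \<le> t" if R: "R \<in> QQ" for R
  proof (cases "measure R A = 0")
    case True
    then show ?thesis using t[OF R] R QQ by (auto simp: expect_lowered[OF A X])
  next
    case False
    then have "measure R A > 0" by (simp add: zero_less_measure_iff)
    then have "expect R X - t \<le> k * measure R A"
      using k[OF R] by (simp add: pos_divide_le_eq)
    then show ?thesis using R QQ by (auto simp: expect_lowered[OF A X])
  qed
  then show ?thesis by blast
qed

section \<open>The extended risk measure as a supremum of expectations\<close>

lemma rho_E_eq_SUP:
  assumes fin: "finite QQ" and ne: "QQ \<noteq> {}" and QQ: "QQ \<subseteq> prob_c M PP"
    and \<rho>: "\<And>X. X \<in> Linf_c M PP \<Longrightarrow> \<rho> X = Max ((\<lambda>R. expect R X) ` QQ)"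
    and Q: "Q \<in> prob_c M PP"
    and S: "S \<in> sets M" and QS: "measure Q (space M - S) = 0"
    and polar: "\<And>N. N \<in> sets M \<Longrightarrow> measure Q N = 0 \<Longrightarrow> N \<inter> S \<in> polar M PP"
    and X: "X \<in> Linf_c M PP"
  shows "rho_E M PP \<rho> Q X =
    (SUP R\<in>{R \<in> QQ. measure R (space M - S) = 0}. ereal (expect R X))"
    (is "_ = (SUP R\<in>?C. _)")
proof (rule antisym)
  show "rho_E M PP \<rho> Q X \<le> (SUP R\<in>?C. ereal (expect R X))"
  proof (rule ereal_le_real)
    fix t assume "(SUP R\<in>?C. ereal (expect R X)) \<le> ereal t"
    then have t: "expect R X \<le> t" if "R \<in> QQ" "measure R (space M - S) = 0" for R
      using that by (simp add: SUP_le_iff)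
    have A: "space M - S \<in> sets M" using S by blast
    obtain k where k: "\<And>R. R \<in> QQ \<Longrightarrow> expect R (lowered (space M - S) k X) \<le> t"
      using exists_lowered_expect_le[OF A X fin QQ t] by blast
    define Y where "Y = lowered (space M - S) k X"
    have Y: "Y \<in> Linf_c M PP" "j_map Q X = j_map Q Y"
      using lowered_in_Linf_c[OF A X] j_map_lowered[OF A X Q QS] by (simp_all add: Y_def)
    have "\<rho> Y \<le> t" using k fin ne Y by (simp add: \<rho> Y_def)
    then show "rho_E M PP \<rho> Q X \<le> ereal t"
      unfolding rho_E_def using Y by (intro Inf_lower imageI) blast
  qed
next
  show "(SUP R\<in>?C. ereal (expect R X)) \<le> rho_E M PP \<rho> Q X"
    unfolding rho_E_def
  proof (intro SUP_least Inf_greatest)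
    fix R r'
    assume R: "R \<in> ?C"
      and "r' \<in> ereal ` {r. j_map Q X \<in> j_map Q ` {Y \<in> Linf_c M PP. \<rho> Y \<le> r}}"
    then obtain r Y where r: "r' = ereal r" and Y: "Y \<in> Linf_c M PP" "\<rho> Y \<le> r"
      and XY: "j_map Q X = j_map Q Y" by blast
    have Rc: "R \<in> prob_c M PP" using R QQ by blast
    have "expect R X = expect R Y"
      by (rule expect_cong_absolutely_continuous[OF Q Rc _ X Y(1) XY])
        (use null_set_if_concentrated_on_support[OF S polar Rc] R in blast)
    also have "\<dots> \<le> \<rho> Y" using R fin Y(1) by (simp add: \<rho>)
    finally show "ereal (expect R X) \<le> r'" using Y(2) r by simp
  qed
qed

end

section \<open>Probability measures as signed measures\<close>

lemma signed_measure_measure: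
  assumes "finite_measure R" and sets: "sets R = sets M"
  shows "signed_measure M (measure R)"
proof -
  interpret finite_measure R by fact
  show ?thesis
    unfolding signed_measure_def using finite_measure_UNION by (simp add: sets)
qed

lemma signed_measure_uminus:
  assumes "signed_measure M \<mu>"
  shows "signed_measure M (\<lambda>A. - \<mu> A)"
  using assms by (auto simp: signed_measure_def intro: sums_minus)

lemma pos_var_measure:
  assumes "finite_measure R" and sets: "sets R = sets M" and A: "A \<in> sets M"
  shows "pos_var M (measure R) A = emeasure R A"
proof -
  interpret finite_measure R by fact
  show ?thesis
    unfolding pos_var_def emeasure_eq_measure
    by (rule antisym)
      (use A sets in \<open>auto intro!: SUP_least SUP_upper finite_measure_mono ennreal_leI\<close>)
qed

lemma pos_var_uminus_measure: "pos_var M (\<lambda>B. - measure R B) A = 0"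
  by (auto simp: pos_var_def ennreal_neg bot_ennreal intro!: antisym SUP_least)

lemma signed_integral_measure:
  assumes R: "finite_measure R" and sets: "sets R = sets M"
  shows "signed_integral M (measure R) X = expect R X"
proof -
  have sm: "signed_measure M (measure R)" by (rule signed_measure_measure[OF R sets])
  have sets_pos_part: "sets (pos_part M \<mu>) = sets M" for \<mu>
    by (simp add: pos_part_def sets.sigma_sets_eq sets.space_closed)
  have pos: "pos_part M (measure R) = R"
    by (rule measure_eqI)
      (simp_all add: sets_pos_part sets emeasure_pos_part[OF sm] pos_var_measure[OF R sets])
  have neg: "pos_part M (\<lambda>A. - measure R A) = null_measure M"
    by (rule measure_eqI)
      (simp_all add: sets_pos_part emeasure_pos_part[OF signed_measure_uminus[OF sm]]
        pos_var_uminus_measure)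
  show ?thesis
    unfolding signed_integral_def pos neg by (simp add: expect_def)
qed

lemma measure_in_ca:
  assumes R: "finite_measure R" and sets: "sets R = sets M"
    and ac: "\<And>N. N \<in> sets M \<Longrightarrow> measure Q N = 0 \<Longrightarrow> measure R N = 0"
  shows "measure R \<in> ca M Q"
proof -
  interpret finite_measure R by fact
  show ?thesis
    unfolding ca_def total_var_def
    using signed_measure_measure[OF R sets] ac
    by (simp add: pos_var_measure[OF R sets] pos_var_uminus_measure emeasure_eq_measure)
qed

section \<open>Biconjugation\<close>

text \<open>This is the Fenchel--Young inequality
  \<open>\<integral> X d\<mu> \<le> \<rho>\<^sup>Q\<^sub>E(X) + \<rho>\<^sup>Q\<close>-bar\<open>(\<mu>)\<close>, rearranged; the rearrangement also holds for infinite
  values.\<close>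

lemma rho_D_le_rho_E:
  assumes X: "X \<in> Linf_c M PP"
  shows "rho_D M PP \<rho> Q X \<le> rho_E M PP \<rho> Q X"
  unfolding rho_D_def
proof (rule SUP_least)
  fix \<mu> assume "\<mu> \<in> ca M Q"
  have "ereal (signed_integral M \<mu> X) - rho_E M PP \<rho> Q X \<le> rho_bar M PP \<rho> Q \<mu>"
    unfolding rho_bar_def using X by (rule SUP_upper)
  then show "ereal (signed_integral M \<mu> X) - rho_bar M PP \<rho> Q \<mu> \<le> rho_E M PP \<rho> Q X"
    by (cases "rho_E M PP \<rho> Q X"; cases "rho_bar M PP \<rho> Q \<mu>") auto
qed

text \<open>A measure whose expectation is dominated by \<open>\<rho>\<^sup>Q\<^sub>E\<close> has penalty at most \<open>0\<close>.\<close>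

lemma expect_le_rho_D:
  assumes R: "finite_measure R" and sets: "sets R = sets M"
    and ac: "\<And>N. N \<in> sets M \<Longrightarrow> measure Q N = 0 \<Longrightarrow> measure R N = 0"
    and le: "\<And>Y. Y \<in> Linf_c M PP \<Longrightarrow> ereal (expect R Y) \<le> rho_E M PP \<rho> Q Y"
  shows "ereal (expect R X) \<le> rho_D M PP \<rho> Q X"
proof -
  have "rho_bar M PP \<rho> Q (measure R) \<le> 0"
    unfolding rho_bar_def signed_integral_measure[OF R sets]
  proof (rule SUP_least)
    fix Y assume "Y \<in> Linf_c M PP"
    from le[OF this] show "ereal (expect R Y) - rho_E M PP \<rho> Q Y \<le> 0"
      by (cases "rho_E M PP \<rho> Q Y") auto
  qed
  then have "ereal (expect R X) \<le> ereal (expect R X) - rho_bar M PP \<rho> Q (measure R)"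
    by (cases "rho_bar M PP \<rho> Q (measure R)") auto
  also have "\<dots> \<le> rho_D M PP \<rho> Q X"
    unfolding rho_D_def signed_integral_measure[OF R sets, of X, symmetric]
    by (rule SUP_upper) (rule measure_in_ca[OF R sets ac])
  finally show ?thesis .
qed

section \<open>Equality of the two extensions\<close>

theorem lemma4p20:
  fixes M :: "'a measure" and PP :: "'a measure set"
    and \<rho> :: "('a \<Rightarrow> real) set \<Rightarrow> real" and QQ :: "'a measure set"
  assumes "PP \<noteq> {}"
    and "\<And>P. P \<in> PP \<Longrightarrow> prob_space P \<and> sets P = sets M"
    and "coherent_risk_measure M PP \<rho>"
    and "finite QQ" and "QQ \<subseteq> prob_c M PP"
    and "\<And>X. X \<in> Linf_c M PP \<Longrightarrow> \<rho> X = Max ((\<lambda>R. expect R X) ` QQ)"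
  shows "\<forall>Q\<in>prob_c M PP. supported M PP Q \<longrightarrow>
    (\<forall>X\<in>Linf_c M PP. rho_E M PP \<rho> Q X = rho_D M PP \<rho> Q X)"
proof (intro ballI impI)
  fix Q X
  assume Q: "Q \<in> prob_c M PP" and supp: "supported M PP Q" and X: "X \<in> Linf_c M PP"
  interpret priors M PP using assms(1,2) by unfold_locales auto
  \<comment> \<open>For empty \<open>QQ\<close> the risk measure would be constant, which contradicts cash-additivity.\<close>
  have ne: "QQ \<noteq> {}"
  proof
    assume "QQ = {}"
    have const: "c_const M PP m \<in> Linf_c M PP" for m
      unfolding c_const_def by (rule qs_class_in_Linf_c[of _ "\<bar>m\<bar>"]) (auto intro: quasi_surelyI)
    have "\<rho> (c_add M PP (c_const M PP 0) (c_const M PP 1)) = \<rho> (c_const M PP 0) + 1"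
      using assms(3) const by (simp add: coherent_risk_measure_def)
    moreover have "c_add M PP (c_const M PP 0) (c_const M PP 1) = c_const M PP 1"
      by (simp add: c_const_def c_add_qs_class)
    ultimately show False
      using assms(6)[OF const[of 0]] assms(6)[OF const[of 1]] \<open>QQ = {}\<close> by simp
  qed
  obtain S where S: "S \<in> sets M" "measure Q (space M - S) = 0"
    and polar: "\<And>N. N \<in> sets M \<Longrightarrow> measure Q N = 0 \<Longrightarrow> N \<inter> S \<in> polar M PP"
    using supp by (auto simp: supported_def)
  have rho_E: "rho_E M PP \<rho> Q Y =
      (SUP R\<in>{R \<in> QQ. measure R (space M - S) = 0}. ereal (expect R Y))"
    if "Y \<in> Linf_c M PP" for Y
    by (rule rho_E_eq_SUP[OF assms(4) ne assms(5) assms(6) Q S polar that])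
  show "rho_E M PP \<rho> Q X = rho_D M PP \<rho> Q X"
  proof (rule antisym)
    show "rho_E M PP \<rho> Q X \<le> rho_D M PP \<rho> Q X"
      unfolding rho_E[OF X]
    proof (rule SUP_least)
      fix R assume R: "R \<in> {R \<in> QQ. measure R (space M - S) = 0}"
      then have Rc: "R \<in> prob_c M PP" using assms(5) by blast
      show "ereal (expect R X) \<le> rho_D M PP \<rho> Q X"
      proof (rule expect_le_rho_D)
        show "finite_measure R" "sets R = sets M"
          using Rc by (auto simp: prob_c_def prob_space.finite_measure)
        show "measure R N = 0" if "N \<in> sets M" "measure Q N = 0" for N
          using null_set_if_concentrated_on_support[OF S(1) polar Rc _ that] R by blast
        show "ereal (expect R Y) \<le> rho_E M PP \<rho> Q Y" if "Y \<in> Linf_c M PP" for Y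
          unfolding rho_E[OF that] using R by (rule SUP_upper)
      qed
    qed
  qed (rule rho_D_le_rho_E[OF X])
qed

end
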